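(* Let $\chi\in\psi$, let $K>0$ and let $f\in Lip_K$. Then for every $(x,y)\in\mathbb{R}^2_+$ and every $w>0$, $$|\tilde I_w^{\chi}(f;x,y)-f(x,y)|\le\frac{K}{4w^2}\left(M_{0,0}+2M_{1,0}+2M_{0,1}+4M_{1,1}\right).$$
   Context: $\mathbb{R}_+=(0,\infty)$, $\mathbb{R}^2_+=\mathbb{R}_+\times\mathbb{R}_+$. $C(\mathbb{R}^2_+)$ is the space of continuous bounded functions on $\mathbb{R}^2_+$. Moments. For $\chi\in C(\mathbb{R}^2_+)$ and $p_1,p_2\in\mathbb{N}_0$, the absolute moments are $$M_{p_1,p_2}=M_{(p_1,p_2)}(\chi)=\sup_{(u,v)\in\mathbb{R}^2_+}\sum_{k\in\mathbb{Z}}\sum_{j\in\mathbb{Z}}|\chi(e^{-k}u,e^{-j}v)|\,|k-\log u|^{p_1}|j-\log v|^{p_2},$$ with $M_\eta(\chi)=\max_{p_1+p_2=\eta}M_{(p_1,p_2)}(\chi)$ for $\eta\in\mathbb{N}_0$. Kernel class. $\psi$ is the class of real-valued $\chi\in C(\mathbb{R}^2_+)$ such that: (K1) $\sum_{k\in\mathbb{Z}}\sum_{j\in\mathbb{Z}}\chi(e^{-k}u,e^{-j}v)=1$ for every $(u,v)\in\mathbb{R}^2_+$; (K2) $M_2(\chi)<+\infty$ and, for all $p_1,p_2\in\mathbb{N}_0$ with $p_1+p_2=2$, $$\lim_{\gamma\to+\infty}\ \sum\sum_{(k,j)\notin B_\gamma(\log u,\log v)}|\chi(e^{-k}u,e^{-j}v)|\,|k-\log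 u|^{p_1}|j-\log v|^{p_2}=0$$ uniformly in $(u,v)\in\mathbb{R}^2_+$, where $(k,j)$ ranges over $\mathbb{Z}^2$ and $B_\gamma(a,b)$ is the open Euclidean disc of radius $\gamma$ centred at $(a,b)\in\mathbb{R}^2$. Operator. For $\chi\in\psi$ and $w>0$, the bivariate Kantorovich exponential sampling series of a locally integrable $g:\mathbb{R}^2_+\to\mathbb{R}$ is $$(I_w^{\chi}g)(x,y)=\sum_{k\in\mathbb{Z}}\sum_{j\in\mathbb{Z}}\chi(e^{-k}x^w,e^{-j}y^w)\,w^2\int_{k/w}^{(k+1)/w}\left(\int_{j/w}^{(j+1)/w}g(e^u,e^v)\,dv\right)du,$$ whenever this series converges. Mellin B-continuity. For $f:\mathbb{R}^2_+\to\mathbb{R}$ and $(s,t),(x,y)\in\mathbb{R}^2_+$ put $$\Delta_{(x,y)}f[s,t;x,y]=f(x,y)-f(x,t)-f(s,y)+f(s,t).$$ $f$ is Mellin $B$-continuous at $(s,t)$ if $\lim_{(x,y)\to(s,t)}\Delta_{(x,y)}f[s,t;x,y]=0$. $\mathcal{C}_b(\mathbb{R}^2_+)$ is the space of functions $f:\mathbb{R}^2_+\to\mathbb{R}$ that are Mellin $B$-continuous at every point of $\mathbb{R}^2_+$. GBS operator. For $f\in\mathcal{C}_b(\mathbb{R}^2_+)$ and $(x,y)\in\mathbb{R}^2_+$, $$\tilde I_w^{\chi}(f;x,y)=(I_w^{\chi}g_{x,y})(x,y),\qquad g_{x,y}(s,t)=f(x,t)+f(s,y)-f(s,t),$$ where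 it is understood that $g_{x,y}$ is locally integrable and the defining series converges. Lipschitz class: for $K>0$, $$Lip_K=\{f\in\mathcal{C}_b(\mathbb{R}^2_+):\ |\Delta_{(x,y)}f[s,t;x,y]|\le K\,|\log s-\log x|\,|\log t-\log y|\ \text{ for all }(s,t),(x,y)\in\mathbb{R}^2_+\}.$$ *)

theory Defs
  imports "HOL-Analysis.Analysis"
begin

text \<open>
  Functions on the open quadrant are modelled as functions on \<open>real \<times> real\<close>; all notions below
  only use their values on \<open>quadrant\<close>. Double series are unordered sums over \<open>int \<times> int\<close>: for
  nonnegative terms this is the iterated sum by Tonelli, and for a kernel in \<open>kernel_class\<close> all
  signed series below converge absolutely, so iterated and unordered sums agree.
\<close>

definition quadrant :: "(real \<times> real) set" where
  "quadrant = {0<..} \<times> {0<..}"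

definition moment_term :: "(real \<times> real \<Rightarrow> real) \<Rightarrow> nat \<Rightarrow> nat \<Rightarrow> real \<Rightarrow> real \<Rightarrow> int \<times> int \<Rightarrow> real" where
  "moment_term \<kappa> p1 p2 u v = (\<lambda>(k, j).
     \<bar>\<kappa> (exp (- real_of_int k) * u, exp (- real_of_int j) * v)\<bar>
       * \<bar>real_of_int k - ln u\<bar> ^ p1 * \<bar>real_of_int j - ln v\<bar> ^ p2)"

text \<open>The absolute moments live in \<open>[0, \<infinity>]\<close>.\<close>

definition abs_moment :: "(real \<times> real \<Rightarrow> real) \<Rightarrow> nat \<Rightarrow> nat \<Rightarrow> ennreal" where
  "abs_moment \<kappa> p1 p2 =
     (SUP (u, v)\<in>quadrant. \<Sum>\<^sub>\<infinity>kj\<in>UNIV. ennreal (moment_term \<kappa> p1 p2 u v kj))"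

definition abs_moment_order :: "(real \<times> real \<Rightarrow> real) \<Rightarrow> nat \<Rightarrow> ennreal" where
  "abs_moment_order \<kappa> \<eta> = Max {abs_moment \<kappa> p1 p2 |p1 p2. p1 + p2 = \<eta>}"

text \<open>
  In the last condition the metric on \<open>real \<times> real\<close>, hence \<open>ball\<close>, is Euclidean, and the
  real-valued tail sums exist because the second-order moments are finite.
\<close>

definition kernel_class :: "(real \<times> real \<Rightarrow> real) set" where
  "kernel_class = {\<kappa>.
     continuous_on quadrant \<kappa> \<and> bounded (\<kappa> ` quadrant) \<and>
     (\<forall>(u, v)\<in>quadrant.
        ((\<lambda>(k, j). \<kappa> (exp (- real_of_int k) * u, exp (- real_of_int j) * v)) has_sum 1)
          (UNIV :: (int \<times> int) set)) \<and>
     abs_moment_order \<kappa> 2 < \<infinity> \<and>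
     (\<forall>p1 p2. p1 + p2 = 2 \<longrightarrow>
        uniform_limit quadrant
          (\<lambda>\<gamma> (u, v). \<Sum>\<^sub>\<infinity>kj\<in>{(k, j). (real_of_int k, real_of_int j) \<notin> ball (ln u, ln v) \<gamma>}.
             moment_term \<kappa> p1 p2 u v kj)
          (\<lambda>_. 0) at_top)}"

definition kantorovich_series ::
    "(real \<times> real \<Rightarrow> real) \<Rightarrow> real \<Rightarrow> (real \<times> real \<Rightarrow> real) \<Rightarrow> real \<Rightarrow> real \<Rightarrow> real" where
  "kantorovich_series \<kappa> w g x y =
     (\<Sum>\<^sub>\<infinity>(k, j)\<in>(UNIV :: (int \<times> int) set).
        \<kappa> (exp (- real_of_int k) * x powr w, exp (- real_of_int j) * y powr w) * w\<^sup>2 *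
        (LINT u:{real_of_int k / w..(real_of_int k + 1) / w}|lebesgue.
          (LINT v:{real_of_int j / w..(real_of_int j + 1) / w}|lebesgue. g (exp u, exp v))))"

definition mixed_diff :: "(real \<times> real \<Rightarrow> real) \<Rightarrow> real \<Rightarrow> real \<Rightarrow> real \<Rightarrow> real \<Rightarrow> real" where
  "mixed_diff f s t x y = f (x, y) - f (x, t) - f (s, y) + f (s, t)"

definition mellin_B_continuous_at :: "(real \<times> real \<Rightarrow> real) \<Rightarrow> real \<Rightarrow> real \<Rightarrow> bool" where
  "mellin_B_continuous_at f s t \<longleftrightarrow>
     ((\<lambda>(x, y). mixed_diff f s t x y) \<longlongrightarrow> 0) (at (s, t) within quadrant)"

definition mellin_B_continuous :: "(real \<times> real \<Rightarrow> real) set" where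
  "mellin_B_continuous = {f. \<forall>(s, t)\<in>quadrant. mellin_B_continuous_at f s t}"

text \<open>
  For \<open>f\<close> in some \<open>mellin_lip K\<close> and \<open>x, y, w > 0\<close> the integrand
  \<open>g(s, t) = f(x, t) + f(s, y) - f(s, t)\<close> is continuous on the quadrant (so locally integrable)
  and grows at most like \<open>\<bar>f(x, y)\<bar> + K \<bar>ln s - ln x\<bar> \<bar>ln t - ln y\<bar>\<close>. Hence for a kernel in
  \<open>kernel_class\<close> the series converges absolutely and no default value of the integral or of the
  infinite sum is involved.
\<close>

definition gbs_operator ::
    "(real \<times> real \<Rightarrow> real) \<Rightarrow> real \<Rightarrow> (real \<times> real \<Rightarrow> real) \<Rightarrow> real \<Rightarrow> real \<Rightarrow> real" where
  "gbs_operator \<kappa> w f x y =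
     kantorovich_series \<kappa> w (\<lambda>(s, t). f (x, t) + f (s, y) - f (s, t)) x y"

definition mellin_lip :: "real \<Rightarrow> (real \<times> real \<Rightarrow> real) set" where
  "mellin_lip K = {f \<in> mellin_B_continuous.
     \<forall>(s, t)\<in>quadrant. \<forall>(x, y)\<in>quadrant.
       \<bar>mixed_diff f s t x y\<bar> \<le> K * \<bar>ln s - ln x\<bar> * \<bar>ln t - ln y\<bar>}"

end

theory Submission
  imports Defs
begin

text \<open>
  Write \<open>D (u, v)\<close> for the mixed difference of \<open>f\<close> with corners \<open>(exp u, exp v)\<close> and \<open>(x, y)\<close>. The
  function averaged by the GBS operator is exactly \<open>f (x, y) - D\<close>, so by the partition of unity (K1)
  the error of the operator is, up to sign, the kernel-weighted sum of the cell means of \<open>D\<close>. The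
  Lipschitz condition gives \<open>\<bar>D (u, v)\<bar> \<le> K * \<bar>u - ln x\<bar> * \<bar>v - ln y\<bar>\<close>. The mean of this product
  over the cell with lower corner \<open>(k / w, j / w)\<close> and side \<open>1 / w\<close> is \<open>K\<close> times two one-dimensional
  means. By
  the triangle inequality through the lower endpoint, these are at most
  \<open>(\<bar>k - w ln x\<bar> + 1/2) / w\<close> and \<open>(\<bar>j - w ln y\<bar> + 1/2) / w\<close> (\<open>integral_abs_diff_le\<close>,
  \<open>iterated_integral_const_minus\<close>). Since
  \<open>w ln x = ln (x powr w)\<close>, multiplying these bounds out and summing against \<open>\<bar>\<kappa>\<bar>\<close> produces the four
  moments with coefficients \<open>1, 2, 2, 4\<close>, up to the common factor \<open>K / (4 w\<^sup>2)\<close>.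

  The integrals exist because \<open>D\<close> is continuous. The Lipschitz condition says nothing about
  continuity of \<open>f\<close> itself, since adding to \<open>f\<close> any function of one variable leaves all mixed
  differences unchanged; but differences of \<open>D\<close> along an axis are again mixed differences of \<open>f\<close>,
  so \<open>D\<close> is locally Lipschitz (\<open>mixed_diff_exp_continuous\<close>). Convergence of the series comes from
  the right-hand side: if a moment there is infinite the bound is void, and otherwise the moments
  dominate the series.
\<close>

section \<open>Mixed differences in logarithmic coordinates\<close>

lemma mellin_lip_bound:
  assumes "f \<in> mellin_lip K" "s > 0" "t > 0" "x > 0" "y > 0"
  shows "\<bar>mixed_diff f s t x y\<bar> \<le> K * \<bar>ln s - ln x\<bar> * \<bar>ln t - ln y\<bar>"
  using assms by (force simp: mellin_lip_def quadrant_def)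

text \<open>
  The increment of the mixed difference from \<open>(u, v)\<close> to \<open>(u', v')\<close>, taken first in \<open>u\<close> and then in
  \<open>v\<close>, is a sum of two mixed differences whose opposite corners, in logarithmic coordinates, are \<open>(u, v)\<close>, \<open>(u', ln y)\<close> and
  \<open>(u', v)\<close>, \<open>(ln x, v')\<close>; each has one short side.
\<close>
lemma mixed_diff_exp_increment:
  assumes "f \<in> mellin_lip K" "x > 0" "y > 0"
  shows "\<bar>mixed_diff f (exp u) (exp v) x y - mixed_diff f (exp u') (exp v') x y\<bar>
    \<le> K * \<bar>u - u'\<bar> * \<bar>v - ln y\<bar> + K * \<bar>u' - ln x\<bar> * \<bar>v - v'\<bar>"
proof -
  have "mixed_diff f (exp u) (exp v) x y - mixed_diff f (exp u') (exp v') x y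
      = mixed_diff f (exp u) (exp v) (exp u') y + mixed_diff f (exp u') (exp v) x (exp v')"
    by (simp add: mixed_diff_def)
  moreover have "\<bar>mixed_diff f (exp u) (exp v) (exp u') y\<bar> \<le> K * \<bar>u - u'\<bar> * \<bar>v - ln y\<bar>"
    using mellin_lip_bound[OF assms(1), of "exp u" "exp v" "exp u'" y] assms by simp
  moreover have "\<bar>mixed_diff f (exp u') (exp v) x (exp v')\<bar> \<le> K * \<bar>u' - ln x\<bar> * \<bar>v - v'\<bar>"
    using mellin_lip_bound[OF assms(1), of "exp u'" "exp v" x "exp v'"] assms by simp
  ultimately show ?thesis by linarith
qed

lemma mixed_diff_exp_continuous:
  assumes "f \<in> mellin_lip K" "x > 0" "y > 0"
  shows "continuous_on S (\<lambda>(u, v). mixed_diff f (exp u) (exp v) x y)" (is "continuous_on S ?D")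
proof -
  have "isCont ?D z" for z
  proof -
    obtain u' v' where z: "z = (u', v')" by force
    have "((\<lambda>p. K * \<bar>fst p - u'\<bar> * \<bar>snd p - ln y\<bar> + K * \<bar>u' - ln x\<bar> * \<bar>snd p - v'\<bar>)
        \<longlongrightarrow> K * \<bar>u' - u'\<bar> * \<bar>v' - ln y\<bar> + K * \<bar>u' - ln x\<bar> * \<bar>v' - v'\<bar>) (at (u', v'))"
      by (intro tendsto_eq_intros | simp)+
    then have "((\<lambda>p. K * \<bar>fst p - u'\<bar> * \<bar>snd p - ln y\<bar> + K * \<bar>u' - ln x\<bar> * \<bar>snd p - v'\<bar>)
        \<longlongrightarrow> 0) (at z)"
      by (simp add: z)
    then have "((\<lambda>p. ?D p - ?D z) \<longlongrightarrow> 0) (at z)"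
      by (rule Lim_null_comparison[rotated])
        (auto simp: z case_prod_unfold mixed_diff_exp_increment[OF assms] intro!: always_eventually)
    then show ?thesis
      by (simp add: isCont_def LIM_zero_iff)
  qed
  then show ?thesis
    by (simp add: continuous_at_imp_continuous_on)
qed

section \<open>Averages over cells\<close>

lemma set_lebesgue_integral_continuous:
  fixes f :: "real \<Rightarrow> real"
  assumes "continuous_on {a..b} f"
  shows "(LINT x:{a..b}|lebesgue. f x) = integral {a..b} f"
  by (rule set_lebesgue_integral_eq_integral(2))
    (rule absolutely_integrable_continuous_real[OF assms])

text \<open>
  The triangle inequality through the endpoint \<open>a\<close> gives \<open>\<bar>u - p\<bar> \<le> (u - a) + \<bar>a - p\<bar>\<close> on the
  interval. The bound need not be sharp, but it has the shape of a first moment centred at \<open>a\<close>.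
\<close>
lemma integral_abs_diff_le:
  fixes a b p :: real
  assumes "a \<le> b"
  shows "integral {a..b} (\<lambda>u. \<bar>u - p\<bar>) \<le> (b - a) * \<bar>a - p\<bar> + (b - a)\<^sup>2 / 2"
proof -
  have *: "((\<lambda>u. u + (\<bar>a - p\<bar> - a)) has_integral
      (b\<^sup>2 - a\<^sup>2) / 2 + (b - a) * (\<bar>a - p\<bar> - a)) {a..b}"
    using has_integral_add[OF ident_has_integral[OF assms]
        has_integral_const_real[of "\<bar>a - p\<bar> - a" a b]] assms by simp
  have "integral {a..b} (\<lambda>u. \<bar>u - p\<bar>) \<le> integral {a..b} (\<lambda>u. u + (\<bar>a - p\<bar> - a))"
    by (intro integral_le integrable_continuous_interval continuous_intros) auto
  also have "\<dots> = (b - a) * \<bar>a - p\<bar> + (b - a)\<^sup>2 / 2"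
    unfolding integral_unique[OF *] by (simp add: power2_eq_square field_simps)
  finally show ?thesis .
qed

lemma iterated_integral_const_minus:
  fixes h :: "real \<Rightarrow> real \<Rightarrow> real"
  assumes cont: "continuous_on UNIV (\<lambda>(u, v). h u v)"
    and bound: "\<And>u v. \<bar>h u v\<bar> \<le> K * \<bar>u - p\<bar> * \<bar>v - q\<bar>"
    and "K \<ge> 0" "a \<le> a'" "b \<le> b'"
  shows "\<bar>(LINT u:{a..a'}|lebesgue. (LINT v:{b..b'}|lebesgue. c - h u v)) - c * (a' - a) * (b' - b)\<bar>
    \<le> K * ((a' - a) * \<bar>a - p\<bar> + (a' - a)\<^sup>2 / 2) * ((b' - b) * \<bar>b - q\<bar> + (b' - b)\<^sup>2 / 2)"
proof -
  define H where "H = (\<lambda>u. integral {b..b'} (h u))"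
  define Q where "Q = integral {b..b'} (\<lambda>v. \<bar>v - q\<bar>)"
  have cont_h: "continuous_on S (h u)" for S u
    using continuous_on_compose2[OF cont, of S "\<lambda>v. (u, v)"] by (simp add: continuous_on_Pair)
  have cont_H: "continuous_on S H" for S
    unfolding H_def using integral_continuous_on_param[of S b b' h] cont
    by (auto intro: continuous_on_subset)
  have inner: "(LINT v:{b..b'}|lebesgue. c - h u v) = c * (b' - b) - H u" for u
    unfolding H_def using \<open>b \<le> b'\<close>
    by (subst set_lebesgue_integral_continuous; (subst integral_diff)?)
      (auto intro!: continuous_intros cont_h integrable_continuous_interval)
  have outer: "(LINT u:{a..a'}|lebesgue. (LINT v:{b..b'}|lebesgue. c - h u v))
      = c * (a' - a) * (b' - b) - integral {a..a'} H"
    unfolding inner using \<open>a \<le> a'\<close>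
    by (subst set_lebesgue_integral_continuous; (subst integral_diff)?)
      (auto intro!: continuous_intros cont_H integrable_continuous_interval)
  have "norm (H u) \<le> K * \<bar>u - p\<bar> * Q" for u
  proof -
    have "norm (H u) \<le> integral {b..b'} (\<lambda>v. K * \<bar>u - p\<bar> * \<bar>v - q\<bar>)"
      unfolding H_def using bound
      by (intro integral_norm_bound_integral integrable_continuous_interval continuous_intros cont_h)
        auto
    then show ?thesis by (simp add: Q_def)
  qed
  then have "norm (integral {a..a'} H) \<le> integral {a..a'} (\<lambda>u. K * \<bar>u - p\<bar> * Q)"
    by (intro integral_norm_bound_integral integrable_continuous_interval continuous_intros cont_H)
      auto
  also have "\<dots> = K * integral {a..a'} (\<lambda>u. \<bar>u - p\<bar>) * Q"
    by simp
  also have "\<dots> \<le> K * ((a' - a) * \<bar>a - p\<bar> + (a' - a)\<^sup>2 / 2) * ((b' - b) * \<bar>b - q\<bar> + (b' - b)\<^sup>2 / 2)"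
    unfolding Q_def using assms
    by (intro mult_mono mult_left_mono integral_abs_diff_le integral_nonneg mult_nonneg_nonneg
        add_nonneg_nonneg integrable_continuous_interval continuous_intros) auto
  finally show ?thesis
    unfolding outer by simp
qed

text \<open>
  For a cell of the grid of mesh \<open>1 / w\<close> the previous bound, normalised by the area, is
  \<open>K / w\<^sup>2 * (\<bar>k - w p\<bar> + 1/2) * (\<bar>j - w q\<bar> + 1/2)\<close>, written here so that the weights of the
  four moments can be read off.
\<close>
lemma grid_cell_average_const_minus:
  fixes h :: "real \<Rightarrow> real \<Rightarrow> real" and k j :: real
  assumes cont: "continuous_on UNIV (\<lambda>(u, v). h u v)"
    and bound: "\<And>u v. \<bar>h u v\<bar> \<le> K * \<bar>u - p\<bar> * \<bar>v - q\<bar>"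
    and "K \<ge> 0" "w > 0"
  shows "\<bar>w\<^sup>2 * (LINT u:{k / w..(k + 1) / w}|lebesgue.
            (LINT v:{j / w..(j + 1) / w}|lebesgue. c - h u v)) - c\<bar>
    \<le> K / (4 * w\<^sup>2) * (1 + 2 * \<bar>k - w * p\<bar> + 2 * \<bar>j - w * q\<bar> + 4 * (\<bar>k - w * p\<bar> * \<bar>j - w * q\<bar>))"
    (is "\<bar>w\<^sup>2 * ?L - c\<bar> \<le> _")
proof -
  have len: "(m + 1) / w - m / w = 1 / w" for m :: real
    by (simp add: diff_divide_distrib[symmetric])
  have dist: "\<bar>m / w - r\<bar> = \<bar>m - w * r\<bar> / w" for m r :: real
  proof -
    have "m / w - r = (m - w * r) / w" using \<open>w > 0\<close> by (simp add: field_simps)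
    then show ?thesis using \<open>w > 0\<close> by (simp add: abs_divide)
  qed
  have "\<bar>?L - c * (1 / w) * (1 / w)\<bar> \<le> K * ((1 / w) * (\<bar>k - w * p\<bar> / w) + (1 / w)\<^sup>2 / 2)
      * ((1 / w) * (\<bar>j - w * q\<bar> / w) + (1 / w)\<^sup>2 / 2)"
    using iterated_integral_const_minus[OF cont bound \<open>K \<ge> 0\<close>, of "k / w" "(k + 1) / w" "j / w"
        "(j + 1) / w" c] \<open>w > 0\<close>
    unfolding len dist by (simp add: divide_right_mono)
  then have "w\<^sup>2 * \<bar>?L - c * (1 / w) * (1 / w)\<bar> \<le> w\<^sup>2 * (K * ((1 / w) * (\<bar>k - w * p\<bar> / w) + (1 / w)\<^sup>2 / 2)
      * ((1 / w) * (\<bar>j - w * q\<bar> / w) + (1 / w)\<^sup>2 / 2))"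
    by (rule mult_left_mono) simp
  also have "w\<^sup>2 * \<bar>?L - c * (1 / w) * (1 / w)\<bar> = \<bar>w\<^sup>2 * (?L - c * (1 / w) * (1 / w))\<bar>"
    by (simp add: abs_mult)
  also have "w\<^sup>2 * (?L - c * (1 / w) * (1 / w)) = w\<^sup>2 * ?L - c"
    using \<open>w > 0\<close> by (simp add: field_simps power2_eq_square)
  also have "w\<^sup>2 * (K * ((1 / w) * (\<bar>k - w * p\<bar> / w) + (1 / w)\<^sup>2 / 2)
      * ((1 / w) * (\<bar>j - w * q\<bar> / w) + (1 / w)\<^sup>2 / 2))
    = K / (4 * w\<^sup>2) * (1 + 2 * \<bar>k - w * p\<bar> + 2 * \<bar>j - w * q\<bar> + 4 * (\<bar>k - w * p\<bar> * \<bar>j - w * q\<bar>))"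
    using \<open>w > 0\<close> by (simp add: field_simps power2_eq_square)
  finally show ?thesis .
qed

section \<open>Summation against the kernel\<close>

lemma infsum_ennreal_finite:
  fixes f :: "'a \<Rightarrow> real"
  assumes nonneg: "\<And>x. f x \<ge> 0" and fin: "(\<Sum>\<^sub>\<infinity>x\<in>A. ennreal (f x)) < \<infinity>"
  shows "f summable_on A" "ennreal (infsum f A) = (\<Sum>\<^sub>\<infinity>x\<in>A. ennreal (f x))"
proof -
  have le: "ennreal (sum f F) \<le> (\<Sum>\<^sub>\<infinity>x\<in>A. ennreal (f x))" if "finite F" "F \<subseteq> A" for F
  proof -
    have "infsum (\<lambda>x. ennreal (f x)) F \<le> (\<Sum>\<^sub>\<infinity>x\<in>A. ennreal (f x))"
      using that by (intro infsum_mono_neutral nonneg_summable_on_complete) auto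
    then show ?thesis using that nonneg by (simp add: sum_ennreal)
  qed
  show *: "f summable_on A"
  proof (rule nonneg_bdd_above_summable_on)
    show "bdd_above (sum f ` {F. F \<subseteq> A \<and> finite F})"
    proof (rule bdd_aboveI2)
      fix F assume "F \<in> {F. F \<subseteq> A \<and> finite F}"
      then show "sum f F \<le> enn2real (\<Sum>\<^sub>\<infinity>x\<in>A. ennreal (f x))"
        using enn2real_mono[OF le[of F]] fin nonneg by (simp add: sum_nonneg)
    qed
  qed (rule nonneg)
  show "ennreal (infsum f A) = (\<Sum>\<^sub>\<infinity>x\<in>A. ennreal (f x))"
    unfolding infsum_nonneg_is_SUPREMUM_ennreal[OF * nonneg]
    by (subst nonneg_infsum_complete) (auto simp: sum_ennreal nonneg intro!: SUP_cong)
qed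

lemma moment_term_infsum_le_abs_moment:
  assumes fin: "abs_moment \<kappa> p1 p2 < \<infinity>" and uv: "(u, v) \<in> quadrant"
  shows "moment_term \<kappa> p1 p2 u v summable_on UNIV"
    "ennreal (\<Sum>\<^sub>\<infinity>kj. moment_term \<kappa> p1 p2 u v kj) \<le> abs_moment \<kappa> p1 p2"
proof -
  have le: "(\<Sum>\<^sub>\<infinity>kj. ennreal (moment_term \<kappa> p1 p2 u v kj)) \<le> abs_moment \<kappa> p1 p2"
    unfolding abs_moment_def by (rule SUP_upper2[OF uv]) simp
  have nonneg: "moment_term \<kappa> p1 p2 u v kj \<ge> 0" for kj
    by (simp add: moment_term_def case_prod_unfold)
  note sums = infsum_ennreal_finite[of "moment_term \<kappa> p1 p2 u v", OF nonneg order.strict_trans1[OF le fin]]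
  show "moment_term \<kappa> p1 p2 u v summable_on UNIV" by (rule sums(1))
  show "ennreal (\<Sum>\<^sub>\<infinity>kj. moment_term \<kappa> p1 p2 u v kj) \<le> abs_moment \<kappa> p1 p2"
    using le unfolding sums(2) .
qed

theorem theorem4p3:
  fixes \<kappa> f :: "real \<times> real \<Rightarrow> real" and K w x y :: real
  assumes "\<kappa> \<in> kernel_class"
    and "K > 0"
    and "f \<in> mellin_lip K"
    and "(x, y) \<in> quadrant"
    and "w > 0"
  shows "ennreal \<bar>gbs_operator \<kappa> w f x y - f (x, y)\<bar>
    \<le> ennreal (K / (4 * w\<^sup>2)) *
       (abs_moment \<kappa> 0 0 + 2 * abs_moment \<kappa> 1 0 + 2 * abs_moment \<kappa> 0 1 + 4 * abs_moment \<kappa> 1 1)"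
proof (cases "abs_moment \<kappa> 0 0 < \<infinity> \<and> abs_moment \<kappa> 1 0 < \<infinity> \<and> abs_moment \<kappa> 0 1 < \<infinity>
    \<and> abs_moment \<kappa> 1 1 < \<infinity>")
  case False
  have "K / (4 * w\<^sup>2) > 0" using assms by simp
  with False show ?thesis
    by (auto simp: top.not_eq_extremum[symmetric] ennreal_mult_top ennreal_top_mult)
next
  case True
  \<comment> \<open>The moments are taken at \<open>(X, Y)\<close>, whose logarithms are the centres \<open>w ln x\<close> and \<open>w ln y\<close> of the cell bounds.\<close>
  define C where "C = K / (4 * w\<^sup>2)"
  define X Y where "X = x powr w" and "Y = y powr w"
  have pos: "x > 0" "y > 0" using assms by (auto simp: quadrant_def)
  then have XY: "(X, Y) \<in> quadrant" and ln: "ln X = w * ln x" "ln Y = w * ln y"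
    by (auto simp: X_def Y_def quadrant_def ln_powr)
  define D where "D = (\<lambda>u v. mixed_diff f (exp u) (exp v) x y)"
  define \<phi> where "\<phi> = (\<lambda>(k :: int, j :: int). \<kappa> (exp (- real_of_int k) * X, exp (- real_of_int j) * Y))"
  define A where "A = (\<lambda>(k :: int, j :: int). w\<^sup>2 *
        (LINT u:{real_of_int k / w..(real_of_int k + 1) / w}|lebesgue.
          (LINT v:{real_of_int j / w..(real_of_int j + 1) / w}|lebesgue. f (x, y) - D u v)))"
  define m where "m = (\<lambda>p1 p2. moment_term \<kappa> p1 p2 X Y)"
  define B where "B = (\<lambda>kj. C * (m 0 0 kj + 2 * m 1 0 kj + 2 * m 0 1 kj + 4 * m 1 1 kj))"

  \<comment> \<open>The averaged function of the GBS operator is \<open>f (x, y) - D\<close> by the definition of \<open>D\<close>.\<close>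
  have gbs: "gbs_operator \<kappa> w f x y = (\<Sum>\<^sub>\<infinity>kj. \<phi> kj * A kj)"
    by (simp add: gbs_operator_def kantorovich_series_def \<phi>_def A_def D_def mixed_diff_def X_def Y_def
        case_prod_unfold algebra_simps)
  have K1: "(\<phi> has_sum 1) UNIV"
    using assms(1) XY unfolding kernel_class_def \<phi>_def by blast
  have cell: "\<bar>\<phi> kj * (A kj - f (x, y))\<bar> \<le> B kj" for kj
  proof -
    obtain k j where kj: "kj = (k, j)" by force
    have "\<bar>D u v\<bar> \<le> K * \<bar>u - ln x\<bar> * \<bar>v - ln y\<bar>" for u v
      using mellin_lip_bound[OF assms(3), of "exp u" "exp v" x y] pos by (simp add: D_def)
    moreover have "continuous_on UNIV (\<lambda>(u, v). D u v)"
      unfolding D_def by (rule mixed_diff_exp_continuous[OF assms(3) pos])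
    ultimately have "\<bar>A kj - f (x, y)\<bar> \<le> C * (1 + 2 * \<bar>k - w * ln x\<bar> + 2 * \<bar>j - w * ln y\<bar>
        + 4 * (\<bar>k - w * ln x\<bar> * \<bar>j - w * ln y\<bar>))"
      unfolding A_def kj C_def prod.case using assms
      by (intro grid_cell_average_const_minus) auto
    then have "\<bar>\<phi> kj\<bar> * \<bar>A kj - f (x, y)\<bar> \<le> \<bar>\<phi> kj\<bar> * (C * (1 + 2 * \<bar>k - w * ln x\<bar>
        + 2 * \<bar>j - w * ln y\<bar> + 4 * (\<bar>k - w * ln x\<bar> * \<bar>j - w * ln y\<bar>)))"
      by (rule mult_left_mono) simp
    also have "\<dots> = B kj"
      by (simp add: B_def m_def moment_term_def kj \<phi>_def ln algebra_simps)
    finally show ?thesis by (simp add: abs_mult)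
  qed

  have sum_m: "m p1 p2 summable_on UNIV" "ennreal (infsum (m p1 p2) UNIV) \<le> abs_moment \<kappa> p1 p2"
    and nonneg_m: "infsum (m p1 p2) UNIV \<ge> 0"
    if "p1 \<in> {0, 1}" "p2 \<in> {0, 1}" for p1 p2
  proof -
    have fin: "abs_moment \<kappa> p1 p2 < \<infinity>" using True that by auto
    show "m p1 p2 summable_on UNIV" "ennreal (infsum (m p1 p2) UNIV) \<le> abs_moment \<kappa> p1 p2"
      unfolding m_def by (rule moment_term_infsum_le_abs_moment[OF fin XY])+
    show "infsum (m p1 p2) UNIV \<ge> 0"
      by (rule infsum_nonneg) (simp add: m_def moment_term_def case_prod_unfold)
  qed
  define s where "s = (\<lambda>p1 p2. infsum (m p1 p2) UNIV)"
  have has_m: "(m p1 p2 has_sum s p1 p2) UNIV" if "p1 \<in> {0, 1}" "p2 \<in> {0, 1}" for p1 p2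
    unfolding s_def by (rule has_sum_infsum[OF sum_m(1)[OF that]])
  have has_B: "(B has_sum C * (s 0 0 + 2 * s 1 0 + 2 * s 0 1 + 4 * s 1 1)) UNIV"
    unfolding B_def by (intro has_sum_cmult_right has_sum_add has_m) auto

  have "(\<lambda>kj. \<phi> kj * (A kj - f (x, y))) summable_on UNIV"
    by (rule Infinite_Sum.abs_summable_summable,
        rule Infinite_Sum.abs_summable_on_comparison_test'[OF has_sum_imp_summable[OF has_B]])
      (use cell in auto)
  then have err: "((\<lambda>kj. \<phi> kj * (A kj - f (x, y))) has_sum (\<Sum>\<^sub>\<infinity>kj. \<phi> kj * (A kj - f (x, y)))) UNIV"
    by (rule has_sum_infsum)
  have "((\<lambda>kj. \<phi> kj * (A kj - f (x, y)) + \<phi> kj * f (x, y)) has_sum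
      (\<Sum>\<^sub>\<infinity>kj. \<phi> kj * (A kj - f (x, y))) + 1 * f (x, y)) UNIV"
    by (intro has_sum_add err has_sum_cmult_left K1)
  then have "gbs_operator \<kappa> w f x y - f (x, y) = (\<Sum>\<^sub>\<infinity>kj. \<phi> kj * (A kj - f (x, y)))"
    unfolding gbs by (simp add: infsumI algebra_simps)
  then have "\<bar>gbs_operator \<kappa> w f x y - f (x, y)\<bar> \<le> C * (s 0 0 + 2 * s 1 0 + 2 * s 0 1 + 4 * s 1 1)"
    using norm_infsum_le[OF err has_B] cell by simp
  then have "ennreal \<bar>gbs_operator \<kappa> w f x y - f (x, y)\<bar>
      \<le> ennreal (C * (s 0 0 + 2 * s 1 0 + 2 * s 0 1 + 4 * s 1 1))"
    by (rule ennreal_leI)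
  also have "\<dots> = ennreal C * (ennreal (s 0 0) + 2 * ennreal (s 1 0) + 2 * ennreal (s 0 1)
      + 4 * ennreal (s 1 1))"
  proof -
    have "C \<ge> 0" "s 0 0 \<ge> 0" "s 1 0 \<ge> 0" "s 0 1 \<ge> 0" "s 1 1 \<ge> 0"
      using assms nonneg_m by (auto simp: C_def s_def)
    then show ?thesis by (simp add: ennreal_mult del: One_nat_def)
  qed
  also have "\<dots> \<le> ennreal C * (abs_moment \<kappa> 0 0 + 2 * abs_moment \<kappa> 1 0 + 2 * abs_moment \<kappa> 0 1
      + 4 * abs_moment \<kappa> 1 1)"
    unfolding s_def by (intro mult_left_mono add_mono sum_m) auto
  finally show ?thesis unfolding C_def .
qed

end
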